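(* Let $G$ be a connected split graph (finite, simple, undirected) with $n \ge 2$ vertices. Then $b(G) \leq 3$. In particular, $b(G) = 3$ only if $\Delta(G) < n-2$, where $\Delta(G)$ is the maximum degree of $G$.
   Context: A split graph is a graph whose vertex set can be partitioned into a clique (a set of mutually adjacent vertices) and an independent set (a set of mutually non-adjacent vertices). One writes $G = (C \cup I, E)$ where $E$ is the edge set, $C$ is a maximal clique and $I = V(G) \setminus C$ is an independent set. Graph burning: initially all vertices of a finite simple undirected graph $G$ are unburned. The process runs in rounds $t = 1, 2, 3, \dots$. In round $t$, a vertex $x_t$ that is not burned at the end of round $t-1$ is chosen as a new source of fire and becomes burned; simultaneously, every vertex adjacent to a vertex that was burned at the end of round $t-1$ becomes burned. Burned vertices remain burned. The process ends at the first round after which all vertices of $G$ are burned. The burning number $b(G)$ is the minimum, over all choices of sources, of the number of rounds needed to burn all vertices of $G$. *)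

theory Defs
  imports "Graph_Theory.Digraph_Component"
begin

text \<open>
  A finite simple undirected graph is a symmetric digraph without loops and multiple arcs (locale
  \<^locale>\<open>graph\<close>): an undirected edge is a pair of opposite arcs, and u is adjacent to v iff
  \<open>u \<rightarrow>\<^bsub>G\<^esub> v\<close>. Hence \<^const>\<open>out_degree\<close> is the degree of a vertex.
\<close>

definition max_degree :: "('a, 'b) pre_digraph \<Rightarrow> nat" where
  "max_degree G = Max (out_degree G ` verts G)"

definition is_clique :: "('a, 'b) pre_digraph \<Rightarrow> 'a set \<Rightarrow> bool" where
  "is_clique G C \<longleftrightarrow> C \<subseteq> verts G \<and> (\<forall>u\<in>C. \<forall>v\<in>C. u \<noteq> v \<longrightarrow> u \<rightarrow>\<^bsub>G\<^esub> v)"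

definition is_independent_set :: "('a, 'b) pre_digraph \<Rightarrow> 'a set \<Rightarrow> bool" where
  "is_independent_set G I \<longleftrightarrow> I \<subseteq> verts G \<and> (\<forall>u\<in>I. \<forall>v\<in>I. \<not> u \<rightarrow>\<^bsub>G\<^esub> v)"

text \<open>Either part may be empty, as usual for split graphs.\<close>

definition split_graph :: "('a, 'b) pre_digraph \<Rightarrow> bool" where
  "split_graph G \<longleftrightarrow>
     (\<exists>C I. C \<union> I = verts G \<and> C \<inter> I = {} \<and> is_clique G C \<and> is_independent_set G I)"

text \<open>
  \<open>burned G x t\<close> is the set of vertices burned at the end of round t when the sources are
  \<open>x 1, x 2, x 3, \<dots>\<close>. The value \<open>x 0\<close> is never used.
\<close>

fun burned :: "('a, 'b) pre_digraph \<Rightarrow> (nat \<Rightarrow> 'a) \<Rightarrow> nat \<Rightarrow> 'a set" where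
  "burned G x 0 = {}"
| "burned G x (Suc t) =
     burned G x t \<union> {v. \<exists>u\<in>burned G x t. u \<rightarrow>\<^bsub>G\<^esub> v} \<union> {x (Suc t)}"

text \<open>
  The process with sources \<open>x 1, \<dots>, x k\<close> is legal and ends with round k. No earlier round can be
  the last one, because every source is unburned when it is chosen.
\<close>

definition burns_in :: "('a, 'b) pre_digraph \<Rightarrow> (nat \<Rightarrow> 'a) \<Rightarrow> nat \<Rightarrow> bool" where
  "burns_in G x k \<longleftrightarrow>
     (\<forall>t\<in>{1..k}. x t \<in> verts G - burned G x (t - 1)) \<and> burned G x k = verts G"

definition burning_number :: "('a, 'b) pre_digraph \<Rightarrow> nat" where
  "burning_number G = (LEAST k. \<exists>x. burns_in G x k)"

text \<open>The minimum is attained: a burning process exists for every finite graph.\<close>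

lemma burned_cong:
  "(\<And>t. 1 \<le> t \<Longrightarrow> t \<le> k \<Longrightarrow> x t = y t) \<Longrightarrow> burned G x k = burned G y k"
  by (induction k) auto

lemma (in graph) burns_in_exists: "\<exists>k x. burns_in G x k"
proof (rule ccontr)
  assume none: "\<nexists>k x. burns_in G x k"
  have "\<exists>x. (\<forall>t\<in>{1..k}. x t \<in> verts G - burned G x (t - 1)) \<and>
            burned G x k \<subseteq> verts G \<and> k \<le> card (burned G x k)" for k
  proof (induction k)
    case (Suc k)
    then obtain x where x: "\<forall>t\<in>{1..k}. x t \<in> verts G - burned G x (t - 1)"
        "burned G x k \<subseteq> verts G" "k \<le> card (burned G x k)" by blast
    have "\<not> burns_in G x k" using none by blast
    then have "burned G x k \<noteq> verts G" using x(1) by (simp add: burns_in_def)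
    then obtain v where v: "v \<in> verts G" "v \<notin> burned G x k" using x(2) by blast
    define y where "y = x(Suc k := v)"
    have eq: "burned G y t = burned G x t" if "t \<le> k" for t
      using that by (intro burned_cong) (auto simp: y_def)
    have 1: "y t \<in> verts G - burned G y (t - 1)" if "t \<in> {1..Suc k}" for t
    proof (cases "t = Suc k")
      case False
      then show ?thesis using x(1) that eq[of "t - 1"] by (auto simp: y_def)
    qed (use v eq in \<open>simp add: y_def\<close>)
    have 2: "burned G y (Suc k) \<subseteq> verts G"
      using x(2) v eq[of k] by (auto simp: y_def dest: adj_in_verts)
    have "insert v (burned G x k) \<subseteq> burned G y (Suc k)"
      using eq[of k] by (auto simp: y_def)
    then have "card (insert v (burned G x k)) \<le> card (burned G y (Suc k))"
      by (rule card_mono[OF finite_subset[OF 2 finite_verts]])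
    moreover have "finite (burned G x k)"
      using x(2) finite_verts finite_subset by blast
    ultimately have "Suc k \<le> card (burned G y (Suc k))"
      using v x(3) by simp
    with 1 2 show ?case by (intro exI[of _ y] conjI ballI)
  qed simp
  from this[of "Suc (card (verts G))"] obtain x where
      sub: "burned G x (Suc (card (verts G))) \<subseteq> verts G" and
      card: "Suc (card (verts G)) \<le> card (burned G x (Suc (card (verts G))))" by (elim exE conjE)
  show False
    using card_mono[OF finite_verts sub] card by linarith
qed

end

theory Submission
  imports Defs
begin

text \<open>
  A first source in the clique burns the whole clique by round 2, and every independent vertex has a
  neighbour in the clique, so that round 3 is the last one. If some vertex has degree at least n - 2,
  then starting there leaves at most one vertex unburned in round 2, which serves as second source.
\<close>

lemma burning_number_le: "burns_in G x k \<Longrightarrow> burning_number G \<le> k"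
  unfolding burning_number_def by (rule Least_le) blast

context graph
begin

text \<open>\<open>out_degree\<close> counts arcs; as there are no multiple arcs,
  \<open>head\<close> maps the arcs leaving \<open>v\<close> bijectively to the neighbours of
  \<open>v\<close>.\<close>

lemma card_dominates_eq_out_degree: "card {w. v \<rightarrow>\<^bsub>G\<^esub> w} = out_degree G v"
proof -
  have "{w. v \<rightarrow>\<^bsub>G\<^esub> w} = head G ` out_arcs G v"
    by (auto simp: arcs_ends_def arc_to_ends_def out_arcs_def)
  moreover have "inj_on (head G) (out_arcs G v)"
    by (auto intro!: inj_onI no_multi_arcs simp: arc_to_ends_def)
  ultimately show ?thesis
    by (simp add: card_image out_degree_def)
qed

lemma connected_imp_neighbour:
  assumes "connected G" "2 \<le> card (verts G)" "u \<in> verts G"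
  shows "\<exists>w. u \<rightarrow>\<^bsub>G\<^esub> w"
proof -
  have "verts G \<noteq> {u}"
    using assms(2) by auto
  then obtain v where "v \<in> verts G" "u \<noteq> v"
    using assms(3) by blast
  \<comment> \<open>\<open>connected\<close> speaks of the symmetrized digraph; symmetry of
    \<open>G\<close> turns this into a directed walk, whose first step leads to a neighbour of
    \<open>u\<close>.\<close>
  have "u \<rightarrow>\<^sup>* v"
    using symmetric_connected_imp_strongly_connected[OF sym_arcs assms(1)] assms(3)
      \<open>v \<in> verts G\<close> by (simp add: strongly_connected_def)
  then show ?thesis
    using \<open>u \<noteq> v\<close> by (cases rule: converse_reachable_cases) auto
qed

text \<open>The second source \<open>w\<close> may be a neighbour of \<open>v\<close>: only
  \<open>v\<close> is burned at the end of round 1, so \<open>w \<noteq> v\<close> is all that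
  legality demands.\<close>

lemma burning_number_le_2:
  assumes "v \<in> verts G" "w \<in> verts G" "w \<noteq> v" "verts G \<subseteq> {v, w} \<union> {u. v \<rightarrow>\<^bsub>G\<^esub> u}"
  shows "burning_number G \<le> 2"
proof (rule burning_number_le)
  define x where "x t = (if t = 1 then v else w)" for t :: nat
  have "burned G x 1 = {v}" "burned G x 2 = {v, w} \<union> {u. v \<rightarrow>\<^bsub>G\<^esub> u}"
    by (auto simp: x_def numeral_2_eq_2)
  moreover have "{1..2} = {1, 2 :: nat}"
    by auto
  ultimately show "burns_in G x 2"
    using assms adj_in_verts by (auto simp: burns_in_def x_def)
qed

lemma burning_number_le_3:
  assumes "v \<in> verts G" "2 \<le> card (verts G)"
    and reach: "\<And>u. u \<in> verts G \<Longrightarrow> u = v \<or> v \<rightarrow>\<^bsub>G\<^esub> u \<or> (\<exists>w. v \<rightarrow>\<^bsub>G\<^esub> w \<and> w \<rightarrow>\<^bsub>G\<^esub> u)"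
  shows "burning_number G \<le> 3"
proof -
  have "verts G \<noteq> {v}"
    using assms(2) by auto
  then obtain w where w: "w \<in> verts G" "w \<noteq> v"
    using assms(1) by blast
  show ?thesis
  \<comment> \<open>A third source must still be unburned after round 2. If none is left, the
    process has already ended in two rounds.\<close>
  proof (cases "verts G \<subseteq> {v, w} \<union> {u. v \<rightarrow>\<^bsub>G\<^esub> u}")
    case True
    then show ?thesis
      using burning_number_le_2[OF assms(1) w] by simp
  next
    case False
    then obtain z where z: "z \<in> verts G" "z \<notin> {v, w} \<union> {u. v \<rightarrow>\<^bsub>G\<^esub> u}"
      by blast
    define x where "x t = (if t = 1 then v else if t = 2 then w else z)" for t :: nat
    have b: "burned G x 1 = {v}" "burned G x 2 = {v, w} \<union> {u. v \<rightarrow>\<^bsub>G\<^esub> u}"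
      by (auto simp: x_def numeral_2_eq_2)
    have b3: "burned G x 3 = burned G x 2 \<union> {u. \<exists>y\<in>burned G x 2. y \<rightarrow>\<^bsub>G\<^esub> u} \<union> {z}"
      by (simp add: x_def eval_nat_numeral)
    have "burned G x 3 = verts G"
      \<comment> \<open>All neighbours of \<open>v\<close> burn by round 2, so \<open>reach\<close>
        makes every remaining vertex catch fire in round 3.\<close>
      unfolding b3 b using assms(1) w z adj_in_verts reach by blast
    moreover have "{1..3} = {1, 2, 3 :: nat}"
      by auto
    ultimately have "burns_in G x 3"
      using assms(1) w z b by (simp add: burns_in_def x_def)
    then show ?thesis
      by (rule burning_number_le)
  qed
qed

lemma split_graph_burning_number_le_3:
  assumes "connected G" "split_graph G" "2 \<le> card (verts G)"
  shows "burning_number G \<le> 3"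
proof -
  obtain C I where CI: "C \<union> I = verts G" "is_clique G C" "is_independent_set G I"
    using assms(2) by (auto simp: split_graph_def)
  have nbr: "\<exists>w\<in>C. w \<rightarrow>\<^bsub>G\<^esub> u" if "u \<in> I" for u
  proof -
    have "u \<in> verts G"
      using that CI(1) by auto
    then obtain w where "u \<rightarrow>\<^bsub>G\<^esub> w"
      using connected_imp_neighbour[OF assms(1,3)] by metis
    moreover have "w \<notin> I"
      using that CI(3) \<open>u \<rightarrow>\<^bsub>G\<^esub> w\<close> by (auto simp: is_independent_set_def)
    ultimately show ?thesis
      using CI(1) adj_in_verts(2) graph_symmetric by (metis UnE)
  qed
  moreover have "verts G \<noteq> {}"
    using assms(3) by auto
  \<comment> \<open>\<open>C\<close> cannot be empty: any vertex lies in \<open>C\<close> or, by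
    \<open>nbr\<close>, has a neighbour there.\<close>
  ultimately obtain v where "v \<in> C"
    using CI(1) by blast
  then have clique: "w = v \<or> v \<rightarrow>\<^bsub>G\<^esub> w" if "w \<in> C" for w
    using that CI(2) by (auto simp: is_clique_def)
  show ?thesis
  proof (rule burning_number_le_3)
    show "v \<in> verts G"
      using \<open>v \<in> C\<close> CI(1) by blast
    show "u = v \<or> v \<rightarrow>\<^bsub>G\<^esub> u \<or> (\<exists>w. v \<rightarrow>\<^bsub>G\<^esub> w \<and> w \<rightarrow>\<^bsub>G\<^esub> u)" if "u \<in> verts G" for u
      using that nbr clique CI(1) by (metis UnE)
  qed (rule assms(3))
qed

text \<open>This is the contrapositive of the degree claim. A vertex of maximum degree and its
  neighbours make up at least n - 1 vertices, so at most one vertex is missed.\<close>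

lemma burning_number_le_2_if_max_degree:
  assumes "2 \<le> card (verts G)" "card (verts G) - 2 \<le> max_degree G"
  shows "burning_number G \<le> 2"
proof -
  have "verts G \<noteq> {}"
    using assms(1) by auto
  then have "max_degree G \<in> out_degree G ` verts G"
    unfolding max_degree_def by (intro Max_in) auto
  then obtain v where v: "v \<in> verts G" "out_degree G v = max_degree G"
    by auto
  define N where "N = insert v {u. v \<rightarrow>\<^bsub>G\<^esub> u}"
  have N: "N \<subseteq> verts G"
    using v(1) adj_in_verts by (auto simp: N_def)
  then have "finite {u. v \<rightarrow>\<^bsub>G\<^esub> u}"
    unfolding N_def by (meson finite_insert finite_subset finite_verts)
  moreover have "\<not> v \<rightarrow>\<^bsub>G\<^esub> v"
    using adj_not_same by blast
  ultimately have "card N = Suc (max_degree G)"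
    using v(2) card_dominates_eq_out_degree by (simp add: N_def)
  then have "card (verts G - N) \<le> 1"
    using assms N card_Diff_subset[OF finite_subset[OF N finite_verts] N] by linarith
  then have rest: "\<forall>a\<in>verts G - N. \<forall>b\<in>verts G - N. a = b"
    by (simp add: card_le_Suc0_iff_eq)
  have "verts G \<noteq> {v}"
    using assms(1) by auto
  \<comment> \<open>The second source is the vertex outside \<open>N\<close> if there is one;
    otherwise any vertex other than \<open>v\<close> serves.\<close>
  then obtain w where "w \<in> verts G" "w \<noteq> v" "verts G \<subseteq> insert w N"
  proof (cases "verts G \<subseteq> N")
    case True
    then show ?thesis
      using that v(1) \<open>verts G \<noteq> {v}\<close> by blast
  next
    case False
    then obtain w where "w \<in> verts G" "w \<notin> N"
      by blast
    then show ?thesis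
      using that[of w] rest by (auto simp: N_def)
  qed
  then show ?thesis
    using v(1) by (intro burning_number_le_2[of v w]) (auto simp: N_def)
qed

end

theorem theorem3p2:
  fixes G :: "('a, 'b) pre_digraph"
  assumes "graph G"
    and "Digraph_Component.connected G"
    and "split_graph G"
    and "card (verts G) \<ge> 2"
  shows "burning_number G \<le> 3 \<and>
    (burning_number G = 3 \<longrightarrow> max_degree G < card (verts G) - 2)"
proof -
  interpret graph G by (rule assms(1))
  show ?thesis
    using split_graph_burning_number_le_3[OF assms(2-4)]
      burning_number_le_2_if_max_degree[OF assms(4)] by linarith
qed

end
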